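(* For every integer $s\ge 3$ there is a constant $c=c(s)>0$ such that for all integers $n\ge 2$, $$f_{s,s+1}(n)\le c(\log n)^{4s^2}\sqrt{n}.$$
   Context: For integers $2\le s<t$ and $n\ge1$, $f_{s,t}(n)$ denotes the minimum, over all $K_t$-free graphs $G$ on $n$ vertices, of the maximum size of a set $W\subseteq V(G)$ such that the induced subgraph $G[W]$ contains no copy of $K_s$. Here $\log$ is the natural logarithm. *)

theory Defs
  imports Complex_Main "HOL-Library.Ramsey"
begin

text \<open>
  A graph is given by its vertex set \<open>V\<close> and its set \<open>E\<close> of edges, each edge being a
  two-element set of vertices, as for \<^const>\<open>clique\<close> in the Ramsey theory.
\<close>

definition simple_graph :: "'a set \<Rightarrow> 'a set set \<Rightarrow> bool" where
  "simple_graph V E \<longleftrightarrow> finite V \<and> E \<subseteq> nsets V 2"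

definition induced_edges :: "'a set set \<Rightarrow> 'a set \<Rightarrow> 'a set set" where
  "induced_edges E W = {e \<in> E. e \<subseteq> W}"

definition K_free :: "nat \<Rightarrow> 'a set \<Rightarrow> 'a set set \<Rightarrow> bool" where
  "K_free r V E \<longleftrightarrow> \<not> (\<exists>K \<in> nsets V r. clique K E)"

definition max_K_free :: "nat \<Rightarrow> 'a set \<Rightarrow> 'a set set \<Rightarrow> nat" where
  "max_K_free s V E = Max {card W | W. W \<subseteq> V \<and> K_free s W (induced_edges E W)}"

text \<open>
  Every graph on \<open>n\<close> vertices is isomorphic to one whose vertices are natural numbers, so
  the minimum may be taken over graphs with vertices in \<^typ>\<open>nat\<close>. The lemmas below show
  that \<^const>\<open>Max\<close> and \<^const>\<open>Min\<close> are applied to finite nonempty sets.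
\<close>

definition erdos_rogers :: "nat \<Rightarrow> nat \<Rightarrow> nat \<Rightarrow> nat" where
  "erdos_rogers s t n =
     Min {max_K_free s V E | V E :: nat set set.
            simple_graph V E \<and> card V = n \<and> K_free t V E}"

lemma finite_K_free_sizes:
  assumes "finite V"
  shows "finite {card W | W. W \<subseteq> V \<and> K_free s W (induced_edges E W)}"
  using assms by simp

lemma K_free_sizes_nonempty:
  assumes "s \<ge> 1"
  shows "{card W | W. W \<subseteq> V \<and> K_free s W (induced_edges E W)} \<noteq> {}"
proof -
  have "K_free s {} (induced_edges E {})"
    using assms by (auto simp: K_free_def nsets_def)
  then show ?thesis by blast
qed

lemma max_K_free_le_card:
  assumes "finite V" "s \<ge> 1"
  shows "max_K_free s V E \<le> card V"
  unfolding max_K_free_def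
  by (rule Max.boundedI[OF finite_K_free_sizes[OF assms(1)] K_free_sizes_nonempty[OF assms(2)]])
    (auto intro: card_mono[OF assms(1)])

lemma finite_erdos_rogers_values:
  assumes "s \<ge> 1"
  shows "finite {max_K_free s V E | V E :: nat set set.
            simple_graph V E \<and> card V = n \<and> K_free t V E}"
  by (rule finite_subset[of _ "{..n}"])
    (use assms in \<open>auto simp: simple_graph_def intro: max_K_free_le_card\<close>)

lemma erdos_rogers_values_nonempty:
  assumes "t \<ge> 2"
  shows "{max_K_free s V E | V E :: nat set set.
            simple_graph V E \<and> card V = n \<and> K_free t V E} \<noteq> {}"
proof -
  have "\<not> clique K {}" if "card K = t" for K :: "nat set"
  proof -
    have "finite K"
      using that assms card.infinite[of K] by fastforce
    moreover have "\<not> card K \<le> Suc 0"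
      using that assms by simp
    ultimately obtain x y where "x \<in> K" "y \<in> K" "x \<noteq> y"
      using card_le_Suc0_iff_eq[of K] by blast
    then show ?thesis by (auto simp: clique_def)
  qed
  then have "simple_graph {..<n} {} \<and> card {..<n} = n \<and> K_free t {..<n} {}"
    by (auto simp: simple_graph_def K_free_def nsets_def)
  then show ?thesis by blast
qed

end

theory Submission
  imports Defs "HOL-Library.Disjoint_Sets"
begin

text \<open>
  Place the vertices in an \<open>N \<times> N\<close> grid with \<open>N\<close> about \<open>sqrt n\<close>, and call two of them joined when
  they lie on a common line with slope among \<open>0, \<dots>, a - 1\<close>, where \<open>a\<close> is a multiple of \<open>ln n\<close>. Two
  points share at most one line, so a joined pair lies in at most \<open>a\<^sup>2\<close> non-collinear triangles of
  joined pairs. Keep each joined pair with probability \<open>1 / B\<close>, where \<open>B\<close> is of order \<open>a\<^sup>2\<close>, and discard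
  the kept pairs that lie in a fully kept non-collinear triangle. Every clique of what remains is
  collinear, while with positive probability every collinear set of \<open>m\<close> points, with \<open>m\<close>
  polylogarithmic, still contains an \<open>s\<close>-clique: the set contains about \<open>m\<^sup>2\<close> edge-disjoint candidates, a
  polylogarithmic proportion of which survive independently of each other, and this beats the
  union bound over \<open>m\<close>-sets.

  Next colour all incidences of a point and a line at random with \<open>s\<close> colours, and keep an edge only
  if its ends have different colours on the line through them. A clique, being collinear, now has
  at most \<open>s\<close> vertices. A set \<open>W\<close> of \<open>2 a N m\<close> vertices contains, for each slope, at least
  \<open>card W / (2 s)\<close> disjoint collinear \<open>s\<close>-cliques, hence \<open>a * card W / (2 s)\<close> cliques with disjoint sets
  of incidences; the choice of \<open>a\<close> makes it likely enough for a union bound over all \<open>W\<close> that one of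
  them is rainbow.
\<close>

section \<open>Independent events in a finite product space\<close>

text \<open>Probability is handled by counting: an event is a subset \<open>A\<close> of
  \<open>\<Omega>\<close>, of probability \<open>card A / card \<Omega>\<close>, and
  \<open>U\<close> holds the coordinates that decide it.\<close>

definition depends_on :: "('e \<Rightarrow> 'c) set \<Rightarrow> 'e set \<Rightarrow> ('e \<Rightarrow> 'c) set \<Rightarrow> bool" where
  "depends_on \<Omega> U A \<longleftrightarrow>
     A \<subseteq> \<Omega> \<and> (\<forall>x\<in>\<Omega>. \<forall>y\<in>\<Omega>. (\<forall>e\<in>U. x e = y e) \<longrightarrow> x \<in> A \<longrightarrow> y \<in> A)"

text \<open>Independence of events decided by disjoint sets of coordinates, cross-multiplied to
  avoid division. Exchanging the coordinates outside \<open>U\<close> between two points is an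
  involution that carries \<open>(A \<inter> B) \<times> \<Omega>\<close> onto
  \<open>A \<times> B\<close>.\<close>

lemma card_Int_depends_on:
  fixes E :: "'e set" and C :: "'c set"
  defines "\<Omega> \<equiv> PiE E (\<lambda>_. C)"
  assumes A: "depends_on \<Omega> U A" and B: "depends_on \<Omega> U' B" and disj: "U \<inter> U' = {}"
  shows "card (A \<inter> B) * card \<Omega> = card A * card B"
proof -
  define mix :: "('e \<Rightarrow> 'c) \<Rightarrow> ('e \<Rightarrow> 'c) \<Rightarrow> 'e \<Rightarrow> 'c"
    where "mix = (\<lambda>x y e. if e \<in> U then x e else y e)"
  have mix: "mix x y \<in> \<Omega>" if "x \<in> \<Omega>" "y \<in> \<Omega>" for x y
    using that unfolding \<Omega>_def mix_def by (auto simp: PiE_iff extensional_def)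
  have sub: "A \<subseteq> \<Omega>" "B \<subseteq> \<Omega>" using A B by (auto simp: depends_on_def)
  have mA: "mix x y \<in> A" if "x \<in> A" "y \<in> \<Omega>" for x y
    using A that sub mix[of x y] unfolding depends_on_def
    by (metis (no_types, lifting) mix_def subsetD)
  have mB: "mix x y \<in> B" if "y \<in> B" "x \<in> \<Omega>" for x y
  proof -
    have "\<forall>e\<in>U'. y e = mix x y e" using disj by (auto simp: mix_def)
    then show ?thesis
      using B that sub mix[of x y] unfolding depends_on_def by blast
  qed
  have inv: "mix (mix x y) (mix y x) = x" for x y
    by (auto simp: mix_def)
  have "bij_betw (\<lambda>(x, y). (mix x y, mix y x)) ((A \<inter> B) \<times> \<Omega>) (A \<times> B)"
    by (rule bij_betw_byWitness[where f' = "\<lambda>(x, y). (mix x y, mix y x)"])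
      (use sub[THEN subsetD] mA mB mix in \<open>simp_all add: inv split_beta image_subset_iff mem_Times_iff\<close>)
  from bij_betw_same_card[OF this] show ?thesis
    by (simp add: card_cartesian_product)
qed

text \<open>Induction with \<open>card_Int_depends_on\<close>: the events already treated are
  jointly decided by the union of their coordinate sets, which is disjoint from that of the next
  event.\<close>

lemma card_INT_depends_on:
  fixes E :: "'e set" and C :: "'c set" and \<rho> :: real
  defines "\<Omega> \<equiv> PiE E (\<lambda>_. C)"
  assumes fin: "finite E" "finite C" "C \<noteq> {}" and I: "finite I"
    and disj: "disjoint_family_on U I" and dep: "\<And>i. i \<in> I \<Longrightarrow> depends_on \<Omega> (U i) (A i)"
    and le: "\<And>i. i \<in> I \<Longrightarrow> real (card (A i)) \<le> \<rho> * real (card \<Omega>)"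
  shows "real (card {x \<in> \<Omega>. \<forall>i\<in>I. x \<in> A i}) \<le> \<rho> ^ card I * real (card \<Omega>)"
  using I disj dep le
proof (induction I rule: finite_induct)
  case empty
  then show ?case by simp
next
  case (insert j I)
  have pos: "card \<Omega> > 0"
    using fin by (simp add: \<Omega>_def card_PiE card_gt_0_iff)
  let ?X = "{x \<in> \<Omega>. \<forall>i\<in>I. x \<in> A i}"
  have X: "depends_on \<Omega> (\<Union>i\<in>I. U i) ?X"
    unfolding depends_on_def
  proof (intro conjI ballI impI)
    fix x y assume xy: "x \<in> \<Omega>" "y \<in> \<Omega>" "\<forall>e\<in>\<Union>i\<in>I. U i. x e = y e" "x \<in> ?X"
    have "y \<in> A i" if "i \<in> I" for i
      using insert.prems(2)[of i] xy that unfolding depends_on_def by simp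
    then show "y \<in> ?X" using xy by simp
  qed blast
  have d: "U j \<inter> (\<Union>i\<in>I. U i) = {}"
    using insert.prems(1) insert.hyps by (force simp: disjoint_family_on_def)
  have eq: "{x \<in> \<Omega>. \<forall>i\<in>insert j I. x \<in> A i} = A j \<inter> ?X"
    using insert.prems(2)[of j] by (auto simp: depends_on_def)
  have IH: "real (card ?X) \<le> \<rho> ^ card I * real (card \<Omega>)"
    using insert.IH insert.prems disjoint_family_on_mono[of I "insert j I" U] by (simp add: subset_insertI)
  have "depends_on \<Omega> (U j) (A j)" using insert.prems(2) by simp
  from card_Int_depends_on[OF this[unfolded \<Omega>_def] X[unfolded \<Omega>_def] d]
  have "card (A j \<inter> ?X) * card \<Omega> = card (A j) * card ?X"
    unfolding \<Omega>_def .
  then have "real (card (A j \<inter> ?X)) * real (card \<Omega>) = real (card (A j)) * real (card ?X)"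
    unfolding of_nat_mult[symmetric] by (rule arg_cong)
  also have "\<dots> \<le> (\<rho> * real (card \<Omega>)) * (\<rho> ^ card I * real (card \<Omega>))"
    using insert.prems(3)[of j] IH by (intro mult_mono) auto
  finally show ?case
    using pos insert.hyps unfolding eq by (simp add: mult.assoc)
qed

text \<open>A target \<open>S\<close> is missed only if at least \<open>r\<close> independent
  events, each of probability at least \<open>q\<close>, all fail; this has probability at most
  \<open>exp (- q * r)\<close>, and a union bound over the targets follows. It serves for the random
  edges and for the random colours.\<close>

lemma exists_meeting_all:
  fixes E :: "'e set" and C :: "'c set" and q r :: real
  defines "\<Omega> \<equiv> PiE E (\<lambda>_. C)"
  assumes fin: "finite E" "finite C" "C \<noteq> {}" and S: "finite \<S>"
    and J: "\<And>S. S \<in> \<S> \<Longrightarrow> finite (J S) \<and> disjoint_family_on U (J S) \<and> r \<le> real (card (J S))"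
    and dep: "\<And>S i. S \<in> \<S> \<Longrightarrow> i \<in> J S \<Longrightarrow> depends_on \<Omega> (U i) (A i)"
    and ge: "\<And>S i. S \<in> \<S> \<Longrightarrow> i \<in> J S \<Longrightarrow> q * real (card \<Omega>) \<le> real (card (A i))"
    and q: "0 \<le> q" "q \<le> 1" and small: "real (card \<S>) * exp (- q * r) < 1"
  shows "\<exists>x\<in>\<Omega>. \<forall>S\<in>\<S>. \<exists>i\<in>J S. x \<in> A i"
proof (rule ccontr)
  assume contra: "\<not> ?thesis"
  have finO: "finite \<Omega>" and pos: "card \<Omega> > 0"
    using fin by (simp_all add: \<Omega>_def card_PiE card_gt_0_iff finite_PiE)
  \<comment> \<open>\<open>F S\<close> is the bad event that \<open>S\<close> is missed; by
    \<open>small\<close> the bad events cannot cover \<open>\<Omega>\<close>.\<close>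
  define F where "F S = {x \<in> \<Omega>. \<forall>i\<in>J S. x \<in> \<Omega> - A i}" for S
  have F: "real (card (F S)) \<le> exp (- q * r) * real (card \<Omega>)" if S: "S \<in> \<S>" for S
  proof -
    have "real (card (F S)) \<le> (1 - q) ^ card (J S) * real (card \<Omega>)"
      unfolding F_def \<Omega>_def
    proof (rule card_INT_depends_on[where U = U, OF fin], unfold \<Omega>_def[symmetric])
      fix i assume i: "i \<in> J S"
      show "depends_on \<Omega> (U i) (\<Omega> - A i)"
        using dep[OF S i] unfolding depends_on_def by (metis DiffD2 DiffI Diff_subset)
      have "A i \<subseteq> \<Omega>" using dep[OF S i] by (simp add: depends_on_def)
      then show "real (card (\<Omega> - A i)) \<le> (1 - q) * real (card \<Omega>)"
        using ge[OF S i] finO by (simp add: card_Diff_subset finite_subset card_mono of_nat_diff algebra_simps)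
    qed (use J[OF S] in auto)
    also have "(1 - q) ^ card (J S) \<le> exp (- q) ^ card (J S)"
      using q exp_ge_add_one_self[of "- q"] by (intro power_mono) auto
    also have "exp (- q) ^ card (J S) = exp (- q * real (card (J S)))"
      by (simp flip: exp_of_nat_mult add: mult.commute)
    also have "\<dots> \<le> exp (- q * r)"
      using J[OF S] q by (simp add: mult_left_mono)
    finally show ?thesis by (simp add: mult_right_mono)
  qed
  have "\<Omega> \<subseteq> (\<Union>S\<in>\<S>. F S)"
    using contra by (auto simp: F_def)
  then have "card \<Omega> \<le> card (\<Union>S\<in>\<S>. F S)"
    using S finO by (intro card_mono) (auto simp: F_def)
  also have "\<dots> \<le> (\<Sum>S\<in>\<S>. card (F S))"
    by (rule card_UN_le[OF S])
  finally have "real (card \<Omega>) \<le> (\<Sum>S\<in>\<S>. real (card (F S)))"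
    by (metis of_nat_le_iff of_nat_sum)
  also have "\<dots> \<le> (\<Sum>S\<in>\<S>. exp (- q * r) * real (card \<Omega>))"
    by (intro sum_mono F)
  also have "\<dots> = real (card \<S>) * exp (- q * r) * real (card \<Omega>)"
    by simp
  also have "\<dots> < 1 * real (card \<Omega>)"
    using small pos by (intro mult_strict_right_mono) auto
  finally show False by simp
qed

lemma card_PiE_prescribed:
  assumes "finite E" "F \<subseteq> E" "finite C" "g ` F \<subseteq> C"
  shows "card {x \<in> PiE E (\<lambda>_. C). \<forall>e\<in>F. x e = g e} * card C ^ card F = card (PiE E (\<lambda>_. C))"
proof -
  have "{x \<in> PiE E (\<lambda>_. C). \<forall>e\<in>F. x e = g e} = PiE E (\<lambda>e. if e \<in> F then {g e} else C)"
    using assms by (fastforce simp: PiE_iff split: if_splits)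
  then have "card {x \<in> PiE E (\<lambda>_. C). \<forall>e\<in>F. x e = g e}
      = (\<Prod>e\<in>E. card (if e \<in> F then {g e} else C))"
    using assms by (simp add: card_PiE)
  also have "\<dots> = (\<Prod>e\<in>E - F. card C)"
    using assms by (intro prod.mono_neutral_cong_right) auto
  finally have "card {x \<in> PiE E (\<lambda>_. C). \<forall>e\<in>F. x e = g e} = card C ^ card (E - F)"
    by simp
  moreover have "card (E - F) + card F = card E"
    using assms by (metis add.commute card_Diff_subset card_mono finite_subset le_add_diff_inverse)
  ultimately show ?thesis
    using assms by (simp add: card_PiE flip: power_add)
qed

text \<open>For a maximal disjoint \<open>J\<close>, every \<open>U i\<close> meets some
  \<open>U j\<close> with \<open>j \<in> J\<close>. Each such \<open>j\<close> accounts for at most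
  \<open>D * D'\<close> indices: it has at most \<open>D\<close> points, each lying in at most
  \<open>D'\<close> sets.\<close>

lemma exists_large_disjoint_subfamily:
  assumes I: "finite I" and U: "\<And>i. i \<in> I \<Longrightarrow> finite (U i) \<and> U i \<noteq> {} \<and> card (U i) \<le> D"
    and deg: "\<And>g. card {i \<in> I. g \<in> U i} \<le> D'"
  shows "\<exists>J\<subseteq>I. disjoint_family_on U J \<and> card I \<le> card J * (D * D')"
proof -
  define P where "P = (\<lambda>J. J \<subseteq> I \<and> disjoint_family_on U J)"
  have "P {}" by (simp add: P_def disjoint_family_on_def)
  moreover have "\<forall>J. P J \<longrightarrow> card J < Suc (card I)"
    using I by (auto simp: P_def less_Suc_eq_le card_mono)
  ultimately obtain J where J: "P J" and max: "\<And>J'. P J' \<Longrightarrow> card J' \<le> card J"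
    using ex_has_greatest_nat[of P "{}" card "Suc (card I)"] by blast
  have finJ: "finite J" and JI: "J \<subseteq> I" using J I finite_subset by (auto simp: P_def)
  have "I \<subseteq> (\<Union>j\<in>J. \<Union>g\<in>U j. {i \<in> I. g \<in> U i})"
  proof
    fix i assume i: "i \<in> I"
    show "i \<in> (\<Union>j\<in>J. \<Union>g\<in>U j. {i \<in> I. g \<in> U i})"
    proof (rule ccontr)
      assume no: "\<not> ?thesis"
      then have d: "U i \<inter> U j = {}" if "j \<in> J" for j using that i by auto
      then have "i \<notin> J" using U[OF i] by blast
      have "P (insert i J)"
        using J i d by (auto simp: P_def disjoint_family_on_def)
      from max[OF this] \<open>i \<notin> J\<close> finJ show False by simp
    qed
  qed
  then have "card I \<le> card (\<Union>j\<in>J. \<Union>g\<in>U j. {i \<in> I. g \<in> U i})"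
    using finJ U JI I by (intro card_mono finite_UN_I) auto
  also have "\<dots> \<le> (\<Sum>j\<in>J. card (\<Union>g\<in>U j. {i \<in> I. g \<in> U i}))"
    by (rule card_UN_le[OF finJ])
  also have "\<dots> \<le> (\<Sum>j\<in>J. D * D')"
  proof (rule sum_mono)
    fix j assume j: "j \<in> J"
    then have fU: "finite (U j)" "card (U j) \<le> D" using U JI by auto
    have "card (\<Union>g\<in>U j. {i \<in> I. g \<in> U i}) \<le> (\<Sum>g\<in>U j. card {i \<in> I. g \<in> U i})"
      by (rule card_UN_le[OF fU(1)])
    also have "\<dots> \<le> (\<Sum>g\<in>U j. D')" by (intro sum_mono deg)
    also have "\<dots> \<le> D * D'" using fU by simp
    finally show "card (\<Union>g\<in>U j. {i \<in> I. g \<in> U i}) \<le> D * D'" .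
  qed
  finally show ?thesis using J by (auto simp: P_def)
qed

section \<open>Union bounds over subsets of the vertex set\<close>

lemma card_nsets_le_exp:
  assumes "finite V" "card V \<le> n" "n \<ge> 1"
  shows "real (card (nsets V m)) \<le> exp (real m * ln (real n))"
proof -
  have "card (nsets V m) = card V choose m" by simp
  also have "\<dots> \<le> (card V choose m) * fact m" by simp
  also have "\<dots> \<le> card V ^ m" by (rule binomial_fact_pow)
  also have "\<dots> \<le> n ^ m" using assms(2) by (rule power_mono) simp
  finally have "real (card (nsets V m)) \<le> real n ^ m"
    by (metis of_nat_le_iff of_nat_power)
  also have "\<dots> = exp (real m * ln (real n))"
    using assms(3) by (simp add: exp_of_nat_mult)
  finally show ?thesis .
qed

text \<open>Supplies the premise \<open>small\<close> of \<open>exists_meeting_all\<close> when the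
  targets are sets of \<open>m\<close> vertices, of which there are at most
  \<open>n ^ m\<close>.\<close>

lemma union_bound_small:
  assumes "finite V" "card V \<le> n" "n \<ge> 1" "\<S> \<subseteq> nsets V m" "real m * ln (real n) < q * r"
  shows "real (card \<S>) * exp (- q * r) < 1"
proof -
  have "card \<S> \<le> card (nsets V m)"
    using assms(1,4) by (intro card_mono finite_imp_finite_nsets)
  then have "real (card \<S>) \<le> real (card (nsets V m))" by simp
  also have "\<dots> \<le> exp (real m * ln (real n))"
    using assms by (intro card_nsets_le_exp)
  also have "\<dots> < exp (q * r)" using assms by simp
  finally have "real (card \<S>) * exp (- q * r) < exp (q * r) * exp (- q * r)"
    by (intro mult_strict_right_mono) auto
  then show ?thesis by (simp flip: exp_add)
qed

lemma ex_nsets_2_mem: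
  assumes "card Q \<ge> 2" "u \<in> Q"
  shows "\<exists>e\<in>nsets Q 2. u \<in> e"
proof -
  have "Q \<noteq> {u}" using assms(1) by auto
  then obtain v where "v \<in> Q" "v \<noteq> u" using assms(2) by blast
  then show ?thesis using assms(2) by (intro bexI[of _ "{u, v}"]) auto
qed

section \<open>Edge-disjoint subsets from affine functions\<close>

text \<open>Division with remainder by the row length \<open>s * p\<close> recovers the row and the
  position in it.\<close>

lemma pair_progressions_inj:
  fixes i i' x x' y y' s p :: nat
  assumes "x + i * y < s * p" "x' + i' * y' < s * p"
    and "i * (s * p) + (x + i * y) = i' * (s * p) + (x' + i' * y')"
  shows "i = i'" and "x + i * y = x' + i' * y'"
proof -
  have div: "(j * (s * p) + z) div (s * p) = j" if "z < s * p" for j z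
    using that by (cases "s * p = 0") (simp_all only: div_mult_self3 div_less, simp_all)
  show "i = i'"
    using div[OF assms(1), of i] div[OF assms(2), of i'] assms(3) by simp
  then show "x + i * y = x' + i' * y'" using assms(3) by simp
qed

text \<open>
  Identify the set with \<open>s\<close> rows of length \<open>s * p\<close>; the members of the family are the graphs of
  the \<open>p ^ 2\<close> affine functions \<open>i \<mapsto> x + i * y\<close> with \<open>x, y < p\<close>, two of which meet at most once.
\<close>
lemma edge_disjoint_subsets:
  assumes S: "finite S" "card S = s ^ 2 * p" and s: "s \<ge> 2"
  shows "\<exists>\<T>. finite \<T> \<and> \<T> \<subseteq> nsets S s \<and> card \<T> = p ^ 2 \<and>
    (\<forall>T\<in>\<T>. \<forall>T'\<in>\<T>. T \<noteq> T' \<longrightarrow> nsets T 2 \<inter> nsets T' 2 = {})"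
proof -
  obtain h where h: "bij_betw h {..<s ^ 2 * p} S"
    using ex_bij_betw_nat_finite[OF S(1)] S(2) by (auto simp: atLeast0LessThan)
  \<comment> \<open>\<open>h\<close> enumerates \<open>S\<close> row by row;
    \<open>\<phi> i c\<close> is the index of the point in row \<open>i\<close> on the graph of the
    affine function with parameters \<open>c\<close>, and \<open>T c\<close> is that graph.\<close>
  define \<phi> where "\<phi> = (\<lambda>i (x, y). i * (s * p) + (x + i * y))"
  define T where "T = (\<lambda>c. (\<lambda>i. h (\<phi> i c)) ` {..<s})"
  let ?C = "{..<p} \<times> {..<p}"
  have lt: "x + i * y < s * p" if "(x, y) \<in> ?C" "i < s" for i x y
  proof -
    have "x + i * y < p + i * p" using that by (intro add_less_le_mono mult_mono) auto
    also have "\<dots> = Suc i * p" by simp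
    also have "\<dots> \<le> s * p" using that by (intro mult_le_mono1) auto
    finally show ?thesis .
  qed
  have \<phi>_lt: "\<phi> i c < s ^ 2 * p" if "c \<in> ?C" "i < s" for i c
  proof -
    obtain x y where c: "c = (x, y)" by force
    have "\<phi> i c < i * (s * p) + s * p" using lt[of x y i] that by (simp add: \<phi>_def c)
    also have "\<dots> = Suc i * (s * p)" by simp
    also have "\<dots> \<le> s * (s * p)" using that by (intro mult_le_mono1) auto
    finally show ?thesis by (simp add: power2_eq_square mult.assoc)
  qed
  have \<phi>_inj: "i = i' \<and> fst c + i * snd c = fst c' + i' * snd c'"
    if "h (\<phi> i c) = h (\<phi> i' c')" "c \<in> ?C" "c' \<in> ?C" "i < s" "i' < s" for i i' c c'
  proof -
    obtain x y x' y' where c: "c = (x, y)" "c' = (x', y')" by force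
    have "\<phi> i c = \<phi> i' c'"
      using h that \<phi>_lt unfolding bij_betw_def inj_on_def by blast
    then show ?thesis
      using pair_progressions_inj[of x i y s p x' i' y'] lt[of x y i] lt[of x' y' i'] that
      by (simp add: \<phi>_def c)
  qed
  have T: "T c \<in> nsets S s" if c: "c \<in> ?C" for c
  proof -
    have "inj_on (\<lambda>i. h (\<phi> i c)) {..<s}"
      using \<phi>_inj c by (intro inj_onI) blast
    moreover have "T c \<subseteq> S"
      using h \<phi>_lt c unfolding T_def bij_betw_def by blast
    ultimately show ?thesis by (simp add: nsets_def T_def card_image)
  qed
  have disj: "c = c'" if cc: "c \<in> ?C" "c' \<in> ?C" and e: "e \<in> nsets (T c) 2" "e \<in> nsets (T c') 2" for c c' e
  proof -
    obtain u v where uv: "e = {u, v}" "u \<noteq> v" "u \<in> T c" "v \<in> T c"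
      using e(1) by (auto elim: nsets2_E)
    have uv': "u \<in> T c'" "v \<in> T c'" using e(2) uv by auto
    obtain i j where i: "u = h (\<phi> i c)" "v = h (\<phi> j c)" "i < s" "j < s"
      using uv by (auto simp: T_def)
    obtain i' j' where i': "u = h (\<phi> i' c')" "v = h (\<phi> j' c')" "i' < s" "j' < s"
      using uv' by (auto simp: T_def)
    have 1: "fst c + i * snd c = fst c' + i * snd c'"
      using \<phi>_inj[of i c i' c'] i i' cc by metis
    have 2: "fst c + j * snd c = fst c' + j * snd c'"
      using \<phi>_inj[of j c j' c'] i i' cc by metis
    have "i \<noteq> j" using uv i by auto
    \<comment> \<open>Affine functions that agree at two distinct arguments have equal slopes; the
      subtraction is done in the integers.\<close>
    have "int (fst c) + int i * int (snd c) = int (fst c') + int i * int (snd c')"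
      "int (fst c) + int j * int (snd c) = int (fst c') + int j * int (snd c')"
      using 1 2 by (metis of_nat_add of_nat_mult)+
    then have "(int i - int j) * (int (snd c) - int (snd c')) = 0"
      by algebra
    with \<open>i \<noteq> j\<close> have "snd c = snd c'" by simp
    with 1 show ?thesis by (simp add: prod_eq_iff)
  qed
  \<comment> \<open>Equal graphs share a pair because \<open>s \<ge> 2\<close>, so
    \<open>disj\<close> also yields injectivity of \<open>T\<close>.\<close>
  have ne: "\<exists>e. e \<in> nsets (T c) 2" if "c \<in> ?C" for c
    using T[OF that] s nsets_eq_empty_iff[of "T c" 2] by (auto simp: nsets_def)
  have "inj_on T ?C"
    by (rule inj_onI) (metis disj ne)
  then have "card (T ` ?C) = p ^ 2"
    by (simp add: card_image power2_eq_square)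
  moreover have "\<forall>A\<in>T ` ?C. \<forall>A'\<in>T ` ?C. A \<noteq> A' \<longrightarrow> nsets A 2 \<inter> nsets A' 2 = {}"
    using disj by blast
  moreover have "T ` ?C \<subseteq> nsets S s" using T by blast
  ultimately show ?thesis by (intro exI[of _ "T ` ?C"]) auto
qed

section \<open>Joined pairs, non-collinear triangles and purging\<close>

text \<open>\<open>f k v\<close> names the line of slope \<open>k\<close> through \<open>v\<close>,
  and \<open>slope_unique\<close> says that two points share at most one line. The argument inside
  the locale uses only this incidence property and no coordinates.\<close>

locale line_classes =
  fixes V :: "'v set" and a :: nat and f :: "nat \<Rightarrow> 'v \<Rightarrow> 'l"
  assumes fin: "finite V" and a_pos: "a \<ge> 1"
    and slope_unique: "\<lbrakk>u \<in> V; v \<in> V; u \<noteq> v; k < a; k' < a; f k u = f k v; f k' u = f k' v\<rbrakk> \<Longrightarrow> k = k'"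
begin

definition on_line :: "nat \<Rightarrow> 'v set \<Rightarrow> bool" where
  "on_line k T \<longleftrightarrow> (\<exists>b. \<forall>u\<in>T. f k u = b)"

definition collinear :: "'v set \<Rightarrow> bool" where
  "collinear T \<longleftrightarrow> (\<exists>k<a. on_line k T)"

definition joined :: "'v set set" where
  "joined = {e \<in> nsets V 2. collinear e}"

definition triangles :: "'v set set" where
  "triangles = {Q \<in> nsets V 3. nsets Q 2 \<subseteq> joined \<and> \<not> collinear Q}"

definition triangles_on :: "'v set \<Rightarrow> 'v set set" where
  "triangles_on e = {Q \<in> triangles. e \<subseteq> Q}"

text \<open>The pairs whose selection can influence whether \<open>e\<close> survives
  purging.\<close>

definition linked :: "'v set \<Rightarrow> 'v set set" where
  "linked e = {g \<in> joined. g = e \<or> (\<exists>Q\<in>triangles. e \<subseteq> Q \<and> g \<subseteq> Q)}"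

text \<open>All pairs of a fully kept triangle are discarded at once, so that survival of a pair is
  a local event with no choices to make.\<close>

definition purge :: "'v set set \<Rightarrow> 'v set set" where
  "purge R = {e \<in> R. \<forall>Q\<in>triangles_on e. \<not> nsets Q 2 \<subseteq> R}"

lemma on_line_subset: "on_line k S \<Longrightarrow> T \<subseteq> S \<Longrightarrow> on_line k T"
  unfolding on_line_def by blast

lemma collinear_subset: "collinear S \<Longrightarrow> T \<subseteq> S \<Longrightarrow> collinear T"
  unfolding collinear_def using on_line_subset by blast

lemma finite_joined: "finite joined"
  using fin by (auto simp: joined_def finite_imp_finite_nsets)

lemma finite_triangles_on: "finite (triangles_on e)"
  using fin by (auto simp: triangles_on_def triangles_def finite_imp_finite_nsets)

lemma nsets_2_subset_joined: "T \<subseteq> V \<Longrightarrow> collinear T \<Longrightarrow> nsets T 2 \<subseteq> joined"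
  using collinear_subset[of T] by (fastforce simp: joined_def nsets_def)

text \<open>The slopes from \<open>u\<close> and \<open>v\<close> to the third vertex determine the
  triangle. Two different third vertices with the same slopes would share both lines, so the two
  slopes would coincide and the triangle would be collinear.\<close>

lemma card_triangles_on:
  assumes e: "e \<in> joined"
  shows "card (triangles_on e) \<le> a ^ 2"
proof -
  obtain u v where uv: "e = {u, v}" "u \<in> V" "v \<in> V" "u \<noteq> v"
    using e by (auto simp: joined_def elim: nsets2_E)
  have "\<exists>w k l. Q = {u, v, w} \<and> w \<in> V \<and> k < a \<and> l < a \<and> f k u = f k w \<and> f l v = f l w"
    if Q: "Q \<in> triangles_on e" for Q
  proof -
    have Q3: "card Q = 3" "Q \<subseteq> V" "finite Q" "{u, v} \<subseteq> Q" "nsets Q 2 \<subseteq> joined"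
      using Q uv by (auto simp: triangles_on_def triangles_def nsets_def)
    then have "card (Q - {u, v}) = 1" using uv by (simp add: card_Diff_subset)
    then obtain w where "Q - {u, v} = {w}" by (auto simp: card_1_singleton_iff)
    then have w: "Q = {u, v, w}" "w \<noteq> u" "w \<noteq> v" using Q3 by auto
    have "{u, w} \<in> joined" "{v, w} \<in> joined" using Q3(5) w by auto
    then obtain k l where "k < a" "l < a" "f k u = f k w" "f l v = f l w"
      by (auto simp: joined_def collinear_def on_line_def)
    then show ?thesis using w Q3 by blast
  qed
  then obtain w k l where
    wkl: "\<And>Q. Q \<in> triangles_on e \<Longrightarrow> Q = {u, v, w Q} \<and> w Q \<in> V \<and> k Q < a \<and> l Q < a \<and>
      f (k Q) u = f (k Q) (w Q) \<and> f (l Q) v = f (l Q) (w Q)"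
    by metis
  have "inj_on (\<lambda>Q. (k Q, l Q)) (triangles_on e)"
  proof (rule inj_onI)
    fix Q Q' assume Q: "Q \<in> triangles_on e" "Q' \<in> triangles_on e" "(k Q, l Q) = (k Q', l Q')"
    show "Q = Q'"
    proof (rule ccontr)
      assume "Q \<noteq> Q'"
      then have "w Q \<noteq> w Q'" using wkl[OF Q(1)] wkl[OF Q(2)] by metis
      moreover have "f (k Q) (w Q) = f (k Q) (w Q')" "f (l Q) (w Q) = f (l Q) (w Q')"
        using wkl[OF Q(1)] wkl[OF Q(2)] Q(3) by auto
      ultimately have kl: "k Q = l Q"
        using slope_unique wkl[OF Q(1)] wkl[OF Q(2)] by blast
      have "f (k Q) u = f (k Q) (w Q)" "f (k Q) v = f (k Q) (w Q)"
        using wkl[OF Q(1)] kl by simp_all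
      then have "on_line (k Q) {u, v, w Q}" by (simp add: on_line_def)
      then have "collinear Q" using wkl[OF Q(1)] unfolding collinear_def by metis
      then show False using Q(1) by (simp add: triangles_on_def triangles_def)
    qed
  qed
  then have "card (triangles_on e) \<le> card ({..<a} \<times> {..<a})"
    using wkl by (intro card_inj_on_le) auto
  then show ?thesis by (simp add: power2_eq_square)
qed

lemma linked_sym: "e \<in> joined \<Longrightarrow> g \<in> linked e \<Longrightarrow> e \<in> linked g"
  by (auto simp: linked_def)

lemma finite_linked: "finite (linked e)"
  using finite_joined by (auto simp: linked_def)

text \<open>Three pairs from each of at most \<open>a ^ 2\<close> triangles, and \<open>e\<close>
  itself, which \<open>a_pos\<close> absorbs into a fourth \<open>a ^ 2\<close>.\<close>

lemma card_linked:
  assumes e: "e \<in> joined"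
  shows "card (linked e) \<le> 4 * a ^ 2"
proof -
  have fin': "finite (nsets Q 2) \<and> card (nsets Q 2) = 3" if "Q \<in> triangles_on e" for Q
    using that by (simp add: triangles_on_def triangles_def nsets_def[of V] finite_imp_finite_nsets card_nsets
        choose_two)
  have "linked e \<subseteq> insert e (\<Union>Q\<in>triangles_on e. nsets Q 2)"
    by (auto simp: linked_def triangles_on_def joined_def nsets_def)
  then have "card (linked e) \<le> card (insert e (\<Union>Q\<in>triangles_on e. nsets Q 2))"
    using fin' finite_triangles_on by (intro card_mono) auto
  also have "\<dots> \<le> Suc (card (\<Union>Q\<in>triangles_on e. nsets Q 2))"
    by (rule card_insert_le_m1) auto
  also have "card (\<Union>Q\<in>triangles_on e. nsets Q 2) \<le> (\<Sum>Q\<in>triangles_on e. card (nsets Q 2))"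
    by (rule card_UN_le[OF finite_triangles_on])
  also have "\<dots> = 3 * card (triangles_on e)" using fin' by simp
  also have "\<dots> \<le> 3 * a ^ 2" using card_triangles_on[OF e] by simp
  finally have "card (linked e) \<le> Suc (3 * a ^ 2)" by simp
  moreover have "1 \<le> a ^ 2" using a_pos by simp
  ultimately show ?thesis by linarith
qed

text \<open>Otherwise every vertex of \<open>Q\<close> lies in \<open>T\<close>, and
  \<open>Q\<close> inherits collinearity.\<close>

lemma triangle_edge_outside:
  assumes "Q \<in> triangles" "collinear T"
  shows "\<exists>g\<in>nsets Q 2. g \<notin> nsets T 2"
proof (rule ccontr)
  assume contra: "\<not> ?thesis"
  have "Q \<subseteq> T"
  proof
    fix u assume u: "u \<in> Q"
    have "card Q \<ge> 2" using assms(1) by (simp add: triangles_def nsets_def)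
    then obtain e where e: "e \<in> nsets Q 2" "u \<in> e" using ex_nsets_2_mem[OF _ u] by blast
    then have "e \<in> nsets T 2" using contra by blast
    then show "u \<in> T" using e by (auto simp: nsets_def)
  qed
  then show False using assms collinear_subset[of T Q] by (simp add: triangles_def)
qed

lemma purge_triangle_free: "Q \<in> triangles \<Longrightarrow> \<not> nsets Q 2 \<subseteq> purge R"
proof
  assume Q: "Q \<in> triangles" "nsets Q 2 \<subseteq> purge R"
  then have "card Q = 3" "finite Q" by (simp_all add: triangles_def nsets_def)
  then obtain e where "e \<in> nsets Q 2" using nsets_eq_empty_iff[of Q 2] by auto
  then have "e \<in> purge R" "Q \<in> triangles_on e" using Q by (auto simp: triangles_on_def nsets_def)
  moreover have "nsets Q 2 \<subseteq> R" using Q by (auto simp: purge_def)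
  ultimately show False by (simp add: purge_def)
qed

section \<open>Random edges that leave a clique in every large collinear set\<close>

text \<open>Each joined pair gets a uniform value below \<open>B\<close> and is kept when the value
  is \<open>0\<close>; this models probability \<open>1 / B\<close>.\<close>

definition purged_cliques :: "nat \<Rightarrow> 'v set \<Rightarrow> ('v set \<Rightarrow> nat) set" where
  "purged_cliques B T =
     {x \<in> PiE joined (\<lambda>_. {..<B}). nsets T 2 \<subseteq> purge {e \<in> joined. x e = 0}}"

lemma depends_on_purged_cliques:
  assumes T: "nsets T 2 \<subseteq> joined"
  shows "depends_on (PiE joined (\<lambda>_. {..<B})) (\<Union>e\<in>nsets T 2. linked e) (purged_cliques B T)"
  unfolding depends_on_def
proof (intro conjI ballI impI)
  fix x y assume x: "x \<in> PiE joined (\<lambda>_. {..<B})" and y: "y \<in> PiE joined (\<lambda>_. {..<B})"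
    and eq: "\<forall>e\<in>\<Union>e\<in>nsets T 2. linked e. x e = y e" and xT: "x \<in> purged_cliques B T"
  have "e \<in> purge {e \<in> joined. y e = 0}" if e: "e \<in> nsets T 2" for e
  proof -
    have xe: "e \<in> purge {e \<in> joined. x e = 0}" using xT e by (auto simp: purged_cliques_def)
    have ej: "e \<in> joined" using e T by blast
    have agree: "x g = y g" if "g \<in> linked e" for g using eq e that by blast
    have "y e = 0" using xe agree[of e] ej by (simp add: purge_def linked_def)
    moreover have "\<not> nsets Q 2 \<subseteq> {e \<in> joined. y e = 0}" if Q: "Q \<in> triangles_on e" for Q
    proof -
      have "nsets Q 2 \<subseteq> linked e"
      proof
        fix g assume g: "g \<in> nsets Q 2"
        then have "g \<in> joined" "e \<subseteq> Q" "g \<subseteq> Q" "Q \<in> triangles"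
          using Q by (auto simp: triangles_on_def triangles_def nsets_def[of Q])
        then show "g \<in> linked e" unfolding linked_def by blast
      qed
      moreover have "\<not> nsets Q 2 \<subseteq> {e \<in> joined. x e = 0}" using xe Q by (simp add: purge_def)
      then obtain g where "g \<in> nsets Q 2" "g \<notin> {e \<in> joined. x e = 0}" by blast
      ultimately have "g \<in> nsets Q 2" "g \<notin> {e \<in> joined. y e = 0}" using agree[of g] by auto
      then show ?thesis by blast
    qed
    ultimately show ?thesis using ej by (simp add: purge_def)
  qed
  then show "y \<in> purged_cliques B T" using y by (auto simp: purged_cliques_def)
qed (auto simp: purged_cliques_def)

text \<open>With \<open>c = s choose 2\<close>, all pairs of \<open>T\<close> are kept with
  probability \<open>1 / B ^ c\<close>. To spoil this, one of at most \<open>c * a ^ 2\<close>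
  triangles must be fully kept, which requires a further pair outside \<open>T\<close> and costs
  another factor \<open>1 / B\<close>. The lower bound on \<open>B\<close> limits the loss to one
  half.\<close>

lemma card_purged_cliques:
  assumes T: "T \<in> nsets V s" "collinear T" and B: "2 * (s choose 2) * a ^ 2 \<le> B" "B \<ge> 1"
  shows "card (PiE joined (\<lambda>_. {..<B})) \<le> 2 * B ^ (s choose 2) * card (purged_cliques B T)"
proof -
  define \<Omega> where "\<Omega> = PiE joined (\<lambda>_. {..<B})"
  define c where "c = s choose 2"
  define zero where "zero F = {x \<in> \<Omega>. \<forall>e\<in>F. x e = 0}" for F
  define \<Q> where "\<Q> = (\<Union>e\<in>nsets T 2. triangles_on e)"
  have finO: "finite \<Omega>" using finite_joined by (simp add: \<Omega>_def finite_PiE)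
  have T': "finite T" "card T = s" "T \<subseteq> V" using T by (auto simp: nsets_def)
  have Tj: "nsets T 2 \<subseteq> joined" using nsets_2_subset_joined T' T(2) by blast
  have cT: "finite (nsets T 2)" "card (nsets T 2) = c"
    using T' by (simp_all add: finite_imp_finite_nsets card_nsets c_def)
  have card_zero: "card (zero F) * B ^ card F = card \<Omega>" if "F \<subseteq> joined" for F
    using card_PiE_prescribed[OF finite_joined that, of "{..<B}" "\<lambda>_. 0"] B(2)
    by (simp add: zero_def \<Omega>_def image_subset_iff)
  have \<Q>: "finite \<Q>" unfolding \<Q>_def using cT finite_triangles_on by auto
  have "card \<Q> \<le> (\<Sum>e\<in>nsets T 2. card (triangles_on e))"
    unfolding \<Q>_def by (rule card_UN_le[OF cT(1)])
  also have "\<dots> \<le> (\<Sum>e\<in>nsets T 2. a ^ 2)"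
    using Tj by (intro sum_mono card_triangles_on) blast
  finally have card\<Q>: "card \<Q> \<le> c * a ^ 2" using cT(2) by simp
  have "\<exists>g\<in>nsets Q 2. g \<notin> nsets T 2" if "Q \<in> \<Q>" for Q
    using that by (intro triangle_edge_outside[OF _ T(2)]) (auto simp: \<Q>_def triangles_on_def)
  then obtain h where h: "\<And>Q. Q \<in> \<Q> \<Longrightarrow> h Q \<in> nsets Q 2 \<and> h Q \<notin> nsets T 2" by metis
  have hj: "h Q \<in> joined" if "Q \<in> \<Q>" for Q
    using h[OF that] that by (auto simp: \<Q>_def triangles_on_def triangles_def)
  have sub: "zero (nsets T 2) \<subseteq> purged_cliques B T \<union> (\<Union>Q\<in>\<Q>. zero (insert (h Q) (nsets T 2)))"
  proof
    fix x assume x: "x \<in> zero (nsets T 2)"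
    show "x \<in> purged_cliques B T \<union> (\<Union>Q\<in>\<Q>. zero (insert (h Q) (nsets T 2)))"
    proof (cases "x \<in> purged_cliques B T")
      case False
      then obtain e where e: "e \<in> nsets T 2" "e \<notin> purge {e \<in> joined. x e = 0}"
        using x by (auto simp: purged_cliques_def zero_def \<Omega>_def)
      moreover have "e \<in> joined" "x e = 0" using e(1) x Tj by (auto simp: zero_def)
      ultimately obtain Q where Q: "Q \<in> triangles_on e" "nsets Q 2 \<subseteq> {e \<in> joined. x e = 0}"
        by (auto simp: purge_def)
      then have "Q \<in> \<Q>" using e by (auto simp: \<Q>_def)
      moreover have "x (h Q) = 0" using Q(2) h[OF \<open>Q \<in> \<Q>\<close>] by auto
      ultimately show ?thesis using x by (auto simp: zero_def)
    qed simp
  qed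
  have "card (zero (nsets T 2)) \<le> card (purged_cliques B T) + card (\<Union>Q\<in>\<Q>. zero (insert (h Q) (nsets T 2)))"
  proof (rule order_trans[OF card_mono[OF _ sub] card_Un_le])
    show "finite (purged_cliques B T \<union> (\<Union>Q\<in>\<Q>. zero (insert (h Q) (nsets T 2))))"
      using finO \<Q> by (auto simp: zero_def purged_cliques_def \<Omega>_def)
  qed
  also have "card (\<Union>Q\<in>\<Q>. zero (insert (h Q) (nsets T 2))) \<le> (\<Sum>Q\<in>\<Q>. card (zero (insert (h Q) (nsets T 2))))"
    by (rule card_UN_le[OF \<Q>])
  finally have le: "card (zero (nsets T 2)) \<le> card (purged_cliques B T) +
    (\<Sum>Q\<in>\<Q>. card (zero (insert (h Q) (nsets T 2))))" by simp
  have one: "card (zero (insert (h Q) (nsets T 2))) * B ^ Suc c = card \<Omega>" if "Q \<in> \<Q>" for Q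
    using card_zero[of "insert (h Q) (nsets T 2)"] hj[OF that] Tj h[OF that] cT by simp
  \<comment> \<open>Scaled by \<open>B ^ Suc c\<close>, keeping \<open>T\<close> counts
    \<open>card \<Omega> * B\<close> and each possible spoiling triangle counts
    \<open>card \<Omega>\<close>.\<close>
  have "card \<Omega> * B = card (zero (nsets T 2)) * B ^ Suc c"
    using card_zero[OF Tj] cT by (simp add: mult.assoc)
  also have "\<dots> \<le> card (purged_cliques B T) * B ^ Suc c +
     (\<Sum>Q\<in>\<Q>. card (zero (insert (h Q) (nsets T 2))) * B ^ Suc c)"
    using mult_le_mono1[OF le, of "B ^ Suc c"] by (simp only: add_mult_distrib sum_distrib_right)
  also have "(\<Sum>Q\<in>\<Q>. card (zero (insert (h Q) (nsets T 2))) * B ^ Suc c) = card \<Q> * card \<Omega>"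
    using one by simp
  finally have "2 * (card \<Omega> * B) \<le> 2 * (card (purged_cliques B T) * B ^ Suc c) + (2 * card \<Q>) * card \<Omega>"
    by simp
  also have "(2 * card \<Q>) * card \<Omega> \<le> B * card \<Omega>"
    using card\<Q> B(1) by (intro mult_le_mono1) (simp add: c_def)
  finally have "card \<Omega> * B \<le> (2 * B ^ c * card (purged_cliques B T)) * B"
    by (simp add: algebra_simps)
  then show ?thesis using B(2) by (simp add: \<Omega>_def c_def)
qed

text \<open>Start from \<open>p ^ 2\<close> edge-disjoint candidates. A pair \<open>g\<close> can
  influence only candidates with a pair in \<open>linked g\<close>, and each such pair belongs to
  one candidate; hence a positive proportion, depending on \<open>s\<close> and \<open>a\<close>,
  has disjoint influence sets.\<close>

lemma independent_cliques:
  assumes S: "S \<in> nsets V (s ^ 2 * p)" "collinear S" and s: "s \<ge> 2"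
  shows "\<exists>J. finite J \<and> J \<subseteq> nsets S s \<and> disjoint_family_on (\<lambda>T. \<Union>e\<in>nsets T 2. linked e) J \<and>
    p ^ 2 \<le> card J * (16 * (s choose 2) * a ^ 4)"
proof -
  have S': "finite S" "card S = s ^ 2 * p" "S \<subseteq> V" using S by (auto simp: nsets_def)
  obtain \<T> where \<T>: "finite \<T>" "\<T> \<subseteq> nsets S s" "card \<T> = p ^ 2"
    and disj: "\<forall>T\<in>\<T>. \<forall>T'\<in>\<T>. T \<noteq> T' \<longrightarrow> nsets T 2 \<inter> nsets T' 2 = {}"
    using edge_disjoint_subsets[OF S'(1,2) s] by (elim exE conjE) (rule that)
  define U where "U = (\<lambda>T. \<Union>e\<in>nsets T 2. linked e)"
  have T: "finite T" "card T = s" "nsets T 2 \<subseteq> joined" if "T \<in> \<T>" for T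
  proof -
    have "T \<in> nsets S s" using that \<T> by blast
    then show "finite T" "card T = s" "nsets T 2 \<subseteq> joined"
      using nsets_2_subset_joined[of T] collinear_subset[OF S(2), of T] S' by (auto simp: nsets_def)
  qed
  have "\<exists>J\<subseteq>\<T>. disjoint_family_on U J \<and> card \<T> \<le> card J * (((s choose 2) * (4 * a ^ 2)) * (4 * a ^ 2))"
  proof (rule exists_large_disjoint_subfamily[OF \<T>(1)])
    fix T assume t: "T \<in> \<T>"
    have fin2: "finite (nsets T 2)" using T[OF t] by (simp add: finite_imp_finite_nsets)
    have "card (U T) \<le> (\<Sum>e\<in>nsets T 2. card (linked e))"
      unfolding U_def by (rule card_UN_le[OF fin2])
    also have "\<dots> \<le> (\<Sum>e\<in>nsets T 2. 4 * a ^ 2)"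
      using T(3)[OF t] by (intro sum_mono card_linked) blast
    also have "\<dots> = (s choose 2) * (4 * a ^ 2)"
      using T[OF t] by (simp add: card_nsets)
    finally have "card (U T) \<le> (s choose 2) * (4 * a ^ 2)" .
    moreover have "U T \<noteq> {}"
    proof -
      obtain e where "e \<in> nsets T 2"
        using T[OF t] s nsets_eq_empty_iff[of T 2] by auto
      then have "e \<in> U T" using T(3)[OF t] by (auto simp: U_def linked_def)
      then show ?thesis by blast
    qed
    ultimately show "finite (U T) \<and> U T \<noteq> {} \<and> card (U T) \<le> (s choose 2) * (4 * a ^ 2)"
      using fin2 finite_linked by (simp add: U_def)
  next
    fix g
    show "card {T \<in> \<T>. g \<in> U T} \<le> 4 * a ^ 2"
    proof (cases "g \<in> joined")
      case True
      have "\<exists>e. e \<in> nsets T 2 \<and> e \<in> linked g" if "T \<in> \<T>" "g \<in> U T" for T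
        using that T(3) linked_sym unfolding U_def by blast
      then obtain e where e: "\<And>T. T \<in> \<T> \<Longrightarrow> g \<in> U T \<Longrightarrow> e T \<in> nsets T 2 \<and> e T \<in> linked g"
        by metis
      have "inj_on e {T \<in> \<T>. g \<in> U T}"
      proof (rule inj_onI)
        fix T T' assume TT: "T \<in> {T \<in> \<T>. g \<in> U T}" "T' \<in> {T \<in> \<T>. g \<in> U T}" "e T = e T'"
        then have "e T \<in> nsets T 2 \<inter> nsets T' 2" using e[of T] e[of T'] by simp
        then show "T = T'" using disj TT by blast
      qed
      then have "card {T \<in> \<T>. g \<in> U T} \<le> card (linked g)"
        using e finite_linked by (intro card_inj_on_le) auto
      then show ?thesis using card_linked[OF True] by simp
    next
      case False
      then have "{T \<in> \<T>. g \<in> U T} = {}" by (auto simp: U_def linked_def)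
      then show ?thesis by (simp only: card.empty le0)
    qed
  qed
  then obtain J where J: "J \<subseteq> \<T>" "disjoint_family_on U J"
    "card \<T> \<le> card J * (((s choose 2) * (4 * a ^ 2)) * (4 * a ^ 2))" by blast
  have "((s choose 2) * (4 * a ^ 2)) * (4 * a ^ 2) = 16 * (s choose 2) * a ^ 4"
    by (simp add: power2_eq_square power4_eq_xxxx)
  then show ?thesis
    using J \<T> finite_subset[OF J(1)] unfolding U_def by (intro exI[of _ J]) auto
qed

text \<open>Each collinear set offers \<open>r\<close> independent candidate cliques, each surviving
  with probability at least \<open>q\<close>; \<open>big\<close> lets this beat the number of sets
  of size \<open>s ^ 2 * p\<close>.\<close>

lemma exists_triangle_free_edges:
  fixes n p B s :: nat
  assumes s: "s \<ge> 2" and n: "card V \<le> n" "n \<ge> 1" and p: "p \<ge> 1"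
    and B: "2 * (s choose 2) * a ^ 2 \<le> B" "B \<ge> 1"
    and big: "32 * real s ^ 2 * real (s choose 2) * real a ^ 4 * real B ^ (s choose 2) * ln (real n) < real p"
  obtains G where "G \<subseteq> joined" "\<And>Q. Q \<in> triangles \<Longrightarrow> \<not> nsets Q 2 \<subseteq> G"
    "\<And>S. S \<in> nsets V (s ^ 2 * p) \<Longrightarrow> collinear S \<Longrightarrow> \<exists>T\<in>nsets S s. nsets T 2 \<subseteq> G"
proof -
  define c where "c = s choose 2"
  define m where "m = s ^ 2 * p"
  have c: "c \<ge> 1" using s by (simp add: c_def Suc_le_eq)
  define U where "U = (\<lambda>T. \<Union>e\<in>nsets T 2. linked e)"
  define \<S> where "\<S> = {S \<in> nsets V m. collinear S}"
  define q where "q = 1 / (2 * real B ^ c)"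
  define r where "r = real p ^ 2 / (16 * real c * real a ^ 4)"
  have "\<exists>J. finite J \<and> J \<subseteq> nsets S s \<and> disjoint_family_on U J \<and> p ^ 2 \<le> card J * (16 * c * a ^ 4)"
    if "S \<in> \<S>" for S
    using independent_cliques[of S s p] that s unfolding \<S>_def m_def U_def c_def by blast
  then obtain J where J: "\<And>S. S \<in> \<S> \<Longrightarrow> finite (J S) \<and> J S \<subseteq> nsets S s \<and>
      disjoint_family_on U (J S) \<and> p ^ 2 \<le> card (J S) * (16 * c * a ^ 4)"
    by metis
  have T: "T \<in> nsets V s" "collinear T" "nsets T 2 \<subseteq> joined" if "S \<in> \<S>" "T \<in> J S" for S T
  proof -
    have "T \<in> nsets S s" using J[OF that(1)] that(2) by blast
    then show "T \<in> nsets V s" "collinear T"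
      using that(1) collinear_subset[of S T] by (auto simp: \<S>_def nsets_def)
    then show "nsets T 2 \<subseteq> joined" using nsets_2_subset_joined[of T] by (auto simp: nsets_def)
  qed
  have "\<exists>x\<in>PiE joined (\<lambda>_. {..<B}). \<forall>S\<in>\<S>. \<exists>T\<in>J S. x \<in> purged_cliques B T"
  proof (rule exists_meeting_all[where U = U and q = q and r = r])
    show "finite joined" by (rule finite_joined)
    show "{..<B} \<noteq> {}" using B(2) by (simp add: lessThan_empty_iff)
    show "finite \<S>" using fin by (simp add: \<S>_def finite_imp_finite_nsets)
    fix S assume S: "S \<in> \<S>"
    have "p ^ 2 \<le> card (J S) * (16 * c * a ^ 4)" using J[OF S] by simp
    from of_nat_mono[OF this, where 'a = real]
    have "real p ^ 2 \<le> real (card (J S)) * (16 * real c * real a ^ 4)" by simp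
    then have "r \<le> real (card (J S))"
      using c a_pos by (simp add: r_def divide_le_eq)
    then show "finite (J S) \<and> disjoint_family_on U (J S) \<and> r \<le> real (card (J S))"
      using J[OF S] by blast
    fix T assume t: "T \<in> J S"
    show "depends_on (PiE joined (\<lambda>_. {..<B})) (U T) (purged_cliques B T)"
      unfolding U_def by (rule depends_on_purged_cliques[OF T(3)[OF S t]])
    have "card (PiE joined (\<lambda>_. {..<B})) \<le> 2 * B ^ c * card (purged_cliques B T)"
      unfolding c_def by (rule card_purged_cliques[OF T(1,2)[OF S t] B])
    from of_nat_mono[OF this, where 'a = real]
    have "real (card (PiE joined (\<lambda>_. {..<B}))) \<le> 2 * real B ^ c * real (card (purged_cliques B T))"
      by simp
    then show "q * real (card (PiE joined (\<lambda>_. {..<B}))) \<le> real (card (purged_cliques B T))"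
      using B(2) by (simp add: q_def divide_le_eq mult.commute)
  next
    have "1 \<le> real B ^ c" using B(2) by simp
    then show "0 \<le> q" "q \<le> 1" by (simp_all add: q_def divide_le_eq)
    show "real (card \<S>) * exp (- q * r) < 1"
    proof (rule union_bound_small[OF fin n, of _ m])
      show "\<S> \<subseteq> nsets V m" by (auto simp: \<S>_def)
      define D where "D = 32 * real c * real a ^ 4 * real B ^ c"
      have D: "D > 0" using c a_pos B(2) by (simp add: D_def)
      have qr: "q * r = real p ^ 2 / D"
        by (simp add: q_def r_def D_def)
      have "real s ^ 2 * D * ln (real n) < real p"
        using big by (simp add: D_def c_def mult_ac)
      \<comment> \<open>\<open>q * r\<close> is quadratic in \<open>p\<close> while the exponent of
        the union bound is linear, so one factor \<open>p\<close> remains to absorb the constants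
        and the logarithm.\<close>
      then have "real p * (real s ^ 2 * D * ln (real n)) < real p * real p"
        using p by (intro mult_strict_left_mono) auto
      then show "real m * ln (real n) < q * r"
        using D by (simp add: qr m_def less_divide_eq power2_eq_square mult_ac)
    qed
  qed auto
  then obtain x where x: "\<And>S. S \<in> \<S> \<Longrightarrow> \<exists>T\<in>J S. x \<in> purged_cliques B T" by blast
  show thesis
  proof (rule that[of "purge {e \<in> joined. x e = 0}"])
    show "purge {e \<in> joined. x e = 0} \<subseteq> joined" by (auto simp: purge_def)
    show "\<not> nsets Q 2 \<subseteq> purge {e \<in> joined. x e = 0}" if "Q \<in> triangles" for Q
      using that by (rule purge_triangle_free)
    fix S assume S: "S \<in> nsets V (s ^ 2 * p)" "collinear S"
    then have S': "S \<in> \<S>" by (simp add: \<S>_def m_def)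
    then obtain T where "T \<in> J S" "x \<in> purged_cliques B T" using x by blast
    then show "\<exists>T\<in>nsets S s. nsets T 2 \<subseteq> purge {e \<in> joined. x e = 0}"
      using J[OF S'] by (auto simp: purged_cliques_def)
  qed
qed

section \<open>Rainbow cliques on lines\<close>

text \<open>For a maximal disjoint family, at most \<open>m\<close> uncovered points of
  \<open>W\<close> remain on each of at most \<open>M\<close> lines, since \<open>m\<close> of them
  would contain a further clique. So at least half of \<open>W\<close> is covered by cliques of size
  \<open>s\<close>.\<close>

lemma disjoint_cliques_on_parallel_lines:
  assumes k: "k < a" and M: "card (f k ` V) \<le> M" and W: "W \<subseteq> V" "card W = 2 * M * m"
    and m: "m \<ge> 1" and s: "s \<ge> 1"
    and G: "\<And>S. S \<in> nsets V m \<Longrightarrow> collinear S \<Longrightarrow> \<exists>T\<in>nsets S s. nsets T 2 \<subseteq> G"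
  shows "\<exists>\<T>. finite \<T> \<and> (\<forall>T\<in>\<T>. T \<in> nsets W s \<and> on_line k T \<and> nsets T 2 \<subseteq> G) \<and>
    disjoint \<T> \<and> M * m \<le> s * card \<T>"
proof -
  define P where "P = (\<lambda>\<T>. (\<forall>T\<in>\<T>. T \<in> nsets W s \<and> on_line k T \<and> nsets T 2 \<subseteq> G) \<and> disjoint \<T>)"
  have finW: "finite W" using fin W finite_subset by blast
  have finP: "finite \<T>" "card \<T> \<le> card (nsets W s)" if "P \<T>" for \<T>
  proof -
    have "\<T> \<subseteq> nsets W s" using that by (auto simp: P_def)
    with finite_imp_finite_nsets[OF finW, of s] show "finite \<T>" "card \<T> \<le> card (nsets W s)"
      by (rule finite_subset[rotated], intro card_mono)
  qed
  have "P {}" by (simp add: P_def)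
  moreover have "\<forall>\<T>. P \<T> \<longrightarrow> card \<T> < Suc (card (nsets W s))"
    using finP(2) by (simp add: less_Suc_eq_le)
  ultimately obtain \<T> where \<T>: "P \<T>" and max: "\<And>\<T>'. P \<T>' \<Longrightarrow> card \<T>' \<le> card \<T>"
    using ex_has_greatest_nat[of P "{}" card "Suc (card (nsets W s))"] by blast
  define X where "X = W - \<Union>\<T>"
  have fiber: "card {v \<in> X. f k v = b} \<le> m" for b
  proof (rule ccontr)
    assume "\<not> ?thesis"
    then obtain S where S: "S \<subseteq> {v \<in> X. f k v = b}" "card S = m" "finite S"
      using obtain_subset_with_card_n[of m "{v \<in> X. f k v = b}"] by auto
    have "S \<in> nsets V m" using S W by (auto simp: X_def nsets_def)
    moreover have line: "on_line k S" using S unfolding on_line_def by (intro exI[of _ b]) auto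
    moreover have "collinear S" using line k by (auto simp: collinear_def)
    ultimately obtain T where T: "T \<in> nsets S s" "nsets T 2 \<subseteq> G" using G[of S] by blast
    have TX: "T \<subseteq> X" "card T = s" "finite T" using T S by (auto simp: nsets_def)
    have "T \<noteq> {}" using TX s by auto
    then have new: "T \<notin> \<T>" using TX by (auto simp: X_def)
    have "P (insert T \<T>)"
      unfolding P_def
    proof
      have "on_line k T" using T on_line_subset[OF line, of T] by (auto simp: nsets_def)
      moreover have "T \<in> nsets W s" using TX by (auto simp: nsets_def X_def)
      ultimately show "\<forall>T\<in>insert T \<T>. T \<in> nsets W s \<and> on_line k T \<and> nsets T 2 \<subseteq> G"
        using \<T> T by (auto simp: P_def)
      show "disjoint (insert T \<T>)"
        using \<T> TX by (auto simp: P_def X_def disjoint_def disjnt_def)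
    qed
    from max[OF this] show False using new finP(1)[OF \<T>] by simp
  qed
  have "X \<subseteq> (\<Union>b\<in>f k ` V. {v \<in> X. f k v = b})" using W by (auto simp: X_def)
  then have "card X \<le> card (\<Union>b\<in>f k ` V. {v \<in> X. f k v = b})"
    using finW fin by (intro card_mono) (auto simp: X_def)
  also have "\<dots> \<le> (\<Sum>b\<in>f k ` V. card {v \<in> X. f k v = b})"
    using fin by (intro card_UN_le) simp
  also have "\<dots> \<le> (\<Sum>b\<in>f k ` V. m)" by (intro sum_mono fiber)
  also have "\<dots> \<le> M * m" using M by simp
  finally have X: "card X \<le> M * m" .
  have "card (\<Union>\<T>) \<le> (\<Sum>T\<in>\<T>. card T)"
    by (rule card_Union_le_sum_card)
  also have "\<dots> = (\<Sum>T\<in>\<T>. s)" using \<T> by (intro sum.cong) (auto simp: P_def nsets_def)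
  finally have U: "card (\<Union>\<T>) \<le> s * card \<T>" by (simp add: mult.commute)
  have "card W \<le> card (X \<union> \<Union>\<T>)"
    using \<T> finW finP(1)[OF \<T>]
    by (intro card_mono) (auto simp: X_def P_def nsets_def)
  also have "\<dots> \<le> card X + card (\<Union>\<T>)" by (rule card_Un_le)
  finally have "2 * M * m \<le> M * m + s * card \<T>" using X U W by linarith
  then show ?thesis using \<T> finP(1)[OF \<T>] by (intro exI[of _ \<T>]) (simp add: P_def)
qed

text \<open>A set \<open>W\<close> contains at least \<open>r\<close> cliques with disjoint sets of
  incidences, counted over all \<open>a\<close> slopes, and each is rainbow with probability at
  least \<open>q\<close>. The factor \<open>a\<close> in \<open>r\<close> pays for the logarithm in
  the union bound.\<close>

lemma exists_rainbow_colouring: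
  fixes n M m s :: nat
  assumes s: "s \<ge> 1" and n: "card V \<le> n" "n \<ge> 1" and m: "m \<ge> 1" and M: "M \<ge> 1"
    and lines: "\<And>k. k < a \<Longrightarrow> card (f k ` V) \<le> M"
    and G: "\<And>S. S \<in> nsets V m \<Longrightarrow> collinear S \<Longrightarrow> \<exists>T\<in>nsets S s. nsets T 2 \<subseteq> G"
    and big: "2 * real s ^ (s + 1) * ln (real n) < real a"
  obtains \<chi> :: "nat \<times> 'v \<Rightarrow> nat" where "\<And>k v. k < a \<Longrightarrow> v \<in> V \<Longrightarrow> \<chi> (k, v) < s"
    "\<And>W. W \<in> nsets V (2 * M * m) \<Longrightarrow>
      \<exists>k<a. \<exists>T\<in>nsets W s. on_line k T \<and> nsets T 2 \<subseteq> G \<and> inj_on (\<lambda>v. \<chi> (k, v)) T"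
proof -
  define w where "w = 2 * M * m"
  define \<Omega> where "\<Omega> = PiE ({..<a} \<times> V) (\<lambda>_. {..<s})"
  \<comment> \<open>Colouring incidences instead of vertices makes cliques of different slopes
    independent even when they share vertices.\<close>
  define U :: "nat \<times> 'v set \<Rightarrow> (nat \<times> 'v) set" where "U = (\<lambda>(k, T). {k} \<times> T)"
  define A where "A = (\<lambda>(k, T). {x \<in> \<Omega>. inj_on (\<lambda>v. x (k, v)) T})"
  define q where "q = 1 / real s ^ s"
  define r where "r = real a * real M * real m / real s"
  have "\<forall>W\<in>nsets V w. \<forall>k\<in>{..<a}. \<exists>\<T>. finite \<T> \<and>
      (\<forall>T\<in>\<T>. T \<in> nsets W s \<and> on_line k T \<and> nsets T 2 \<subseteq> G) \<and> disjoint \<T> \<and> M * m \<le> s * card \<T>"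
  proof (intro ballI)
    fix W k assume "W \<in> nsets V w" "k \<in> {..<a}"
    then have "W \<subseteq> V" "card W = 2 * M * m" "k < a" by (auto simp: nsets_def w_def)
    then show "\<exists>\<T>. finite \<T> \<and>
      (\<forall>T\<in>\<T>. T \<in> nsets W s \<and> on_line k T \<and> nsets T 2 \<subseteq> G) \<and> disjoint \<T> \<and> M * m \<le> s * card \<T>"
      by (intro disjoint_cliques_on_parallel_lines lines m s G)
  qed
  then obtain \<T> where \<T>: "\<forall>W\<in>nsets V w. \<forall>k\<in>{..<a}. finite (\<T> W k) \<and>
      (\<forall>T\<in>\<T> W k. T \<in> nsets W s \<and> on_line k T \<and> nsets T 2 \<subseteq> G) \<and> disjoint (\<T> W k) \<and>
      M * m \<le> s * card (\<T> W k)"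
    unfolding bchoice_iff by (elim exE) (rule that)
  define J where "J = (\<lambda>W. Sigma {..<a} (\<T> W))"
  have "\<exists>x\<in>PiE ({..<a} \<times> V) (\<lambda>_. {..<s}). \<forall>W\<in>nsets V w. \<exists>i\<in>J W. x \<in> A i"
  proof (rule exists_meeting_all[where U = U and q = q and r = r], fold \<Omega>_def)
    show "finite ({..<a} \<times> V)" using fin by simp
    show "{..<s} \<noteq> {}" using s by (simp add: lessThan_empty_iff)
    show "finite (nsets V w)" using fin by (simp add: finite_imp_finite_nsets)
    show "0 \<le> q" "q \<le> 1" using s by (simp_all add: q_def divide_le_eq)
    fix W assume W: "W \<in> nsets V w"
    show "finite (J W) \<and> disjoint_family_on U (J W) \<and> r \<le> real (card (J W))"
    proof (intro conjI)
      show "finite (J W)" using \<T> W by (auto simp: J_def)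
      have dis: "T \<inter> T' = {}" if "k < a" "T \<in> \<T> W k" "T' \<in> \<T> W k" "T \<noteq> T'" for k T T'
      proof -
        have "disjoint (\<T> W k)" using \<T> W that(1) by simp
        then show ?thesis using that by (simp add: disjointD)
      qed
      show "disjoint_family_on U (J W)"
        unfolding disjoint_family_on_def
      proof (intro ballI impI)
        fix i j assume ij: "i \<in> J W" "j \<in> J W" "i \<noteq> j"
        obtain k T l T' where eq: "i = (k, T)" "j = (l, T')" by (metis surj_pair)
        then have "k < a" "T \<in> \<T> W k" "T' \<in> \<T> W l" "k \<noteq> l \<or> T \<noteq> T'"
          using ij by (auto simp: J_def)
        then show "U i \<inter> U j = {}" using dis[of k T T'] by (auto simp: U_def eq)
      qed
      have "a * (M * m) = (\<Sum>k<a. M * m)" by simp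
      also have "\<dots> \<le> (\<Sum>k<a. s * card (\<T> W k))" using \<T> W by (intro sum_mono) simp
      also have "\<dots> = s * card (J W)"
        using \<T> W by (simp add: J_def card_SigmaI sum_distrib_left)
      finally have "real (a * (M * m)) \<le> real (s * card (J W))" by (rule of_nat_mono)
      then show "r \<le> real (card (J W))"
        using s by (simp add: r_def divide_le_eq mult_ac)
    qed
    fix i assume "i \<in> J W"
    then obtain k T where i: "i = (k, T)" "k < a" "T \<in> \<T> W k" by (auto simp: J_def)
    have "T \<in> nsets W s" using \<T> W i by simp
    then have T: "finite T" "card T = s" "T \<subseteq> V" using W by (auto simp: nsets_def)
    show "depends_on \<Omega> (U i) (A i)"
      unfolding depends_on_def
    proof (intro conjI ballI impI)
      fix x y assume "y \<in> \<Omega>" "\<forall>e\<in>U i. x e = y e" "x \<in> A i"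
      then show "y \<in> A i" by (simp add: A_def i U_def inj_on_def)
    qed (auto simp: A_def i)
    \<comment> \<open>A crude bound suffices: a single prescribed bijection to the colours already
      has probability \<open>1 / s ^ s\<close>.\<close>
    obtain g where g: "bij_betw g T {..<s}"
      using ex_bij_betw_finite_nat[OF T(1)] T(2) by (auto simp: atLeast0LessThan)
    let ?X = "{x \<in> PiE ({..<a} \<times> V) (\<lambda>_. {..<s}). \<forall>e\<in>{k} \<times> T. x e = g (snd e)}"
    have "card ?X * card {..<s} ^ card ({k} \<times> T) = card (PiE ({..<a} \<times> V) (\<lambda>_. {..<s}))"
      using fin T i bij_betwE[OF g] by (intro card_PiE_prescribed) auto
    then have eq: "card ?X * s ^ s = card \<Omega>"
      by (simp add: \<Omega>_def card_cartesian_product T)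
    have "?X \<subseteq> A i"
      using bij_betw_imp_inj_on[OF g] by (auto simp: A_def i \<Omega>_def inj_on_def)
    moreover have "finite (A i)" using fin by (auto simp: A_def i \<Omega>_def finite_PiE)
    ultimately have "card ?X \<le> card (A i)" by (rule card_mono[rotated])
    then have "real (card ?X) * real (s ^ s) \<le> real (card (A i)) * real (s ^ s)" by (intro mult_right_mono) auto
    then have "real (card \<Omega>) \<le> real (card (A i)) * real s ^ s"
      unfolding eq[symmetric] by simp
    then show "q * real (card \<Omega>) \<le> real (card (A i))"
      using s by (simp add: q_def divide_le_eq)
  next
    show "real (card (nsets V w)) * exp (- q * r) < 1"
    proof (rule union_bound_small[OF fin n subset_refl])
      define D where "D = real s ^ (s + 1)"
      have D: "D > 0" using s by (simp add: D_def)
      have qr: "q * r = real M * real m * real a / D" by (simp add: q_def r_def D_def mult_ac)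
      have "real M * real m * (2 * D * ln (real n)) < real M * real m * real a"
        using big M m by (intro mult_strict_left_mono) (auto simp: D_def)
      then show "real w * ln (real n) < q * r"
        using D by (simp add: qr w_def less_divide_eq mult_ac)
    qed
  qed auto
  then obtain x where x: "x \<in> \<Omega>" "\<forall>W\<in>nsets V w. \<exists>i\<in>J W. x \<in> A i" by (auto simp: \<Omega>_def)
  show thesis
  proof (rule that[of x])
    show "x (k, v) < s" if "k < a" "v \<in> V" for k v
      using x(1) that by (auto simp: \<Omega>_def PiE_iff)
    fix W assume "W \<in> nsets V (2 * M * m)"
    then have W: "W \<in> nsets V w" by (simp add: w_def)
    then obtain i where "i \<in> J W" "x \<in> A i" using x(2) by blast
    then obtain k T where kT: "k < a" "T \<in> \<T> W k" "inj_on (\<lambda>v. x (k, v)) T"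
      by (auto simp: J_def A_def)
    have "T \<in> nsets W s \<and> on_line k T \<and> nsets T 2 \<subseteq> G" using \<T> W kT(1,2) by simp
    with kT show "\<exists>k<a. \<exists>T\<in>nsets W s. on_line k T \<and> nsets T 2 \<subseteq> G \<and> inj_on (\<lambda>v. x (k, v)) T"
      by blast
  qed
qed

text \<open>The edges of \<open>G\<close> whose ends differ in colour on their common line. A clique
  lies on one line, where its vertices have distinct colours, so it has at most \<open>s\<close>
  vertices; a rainbow clique of \<open>G\<close> on a line survives.\<close>

lemma exists_graph_without_large_K_free_set:
  fixes n M p B s :: nat
  assumes s: "s \<ge> 2" and n: "card V \<le> n" "n \<ge> 1" and p: "p \<ge> 1" and M: "M \<ge> 1"
    and B: "2 * (s choose 2) * a ^ 2 \<le> B" "B \<ge> 1"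
    and p_big: "32 * real s ^ 2 * real (s choose 2) * real a ^ 4 * real B ^ (s choose 2) * ln (real n) < real p"
    and lines: "\<And>k. k < a \<Longrightarrow> card (f k ` V) \<le> M"
    and a_big: "2 * real s ^ (s + 1) * ln (real n) < real a"
  shows "\<exists>E. simple_graph V E \<and> K_free (s + 1) V E \<and>
    (\<forall>W\<in>nsets V (2 * M * (s ^ 2 * p)). \<not> K_free s W (induced_edges E W))"
proof -
  obtain G where G: "G \<subseteq> joined" "\<And>Q. Q \<in> triangles \<Longrightarrow> \<not> nsets Q 2 \<subseteq> G"
    "\<And>S. S \<in> nsets V (s ^ 2 * p) \<Longrightarrow> collinear S \<Longrightarrow> \<exists>T\<in>nsets S s. nsets T 2 \<subseteq> G"
    using exists_triangle_free_edges[OF s n p B p_big] by metis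
  have "s ^ 2 * p \<ge> 1" "s \<ge> 1" using s p by simp_all
  obtain \<chi> :: "nat \<times> 'v \<Rightarrow> nat" where \<chi>: "\<And>k v. k < a \<Longrightarrow> v \<in> V \<Longrightarrow> \<chi> (k, v) < s"
    "\<And>W. W \<in> nsets V (2 * M * (s ^ 2 * p)) \<Longrightarrow>
      \<exists>k<a. \<exists>T\<in>nsets W s. on_line k T \<and> nsets T 2 \<subseteq> G \<and> inj_on (\<lambda>v. \<chi> (k, v)) T"
    using exists_rainbow_colouring[OF \<open>s \<ge> 1\<close> n \<open>s ^ 2 * p \<ge> 1\<close> M lines G(3) a_big] by metis
  define E where "E = {e \<in> G. \<exists>k<a. on_line k e \<and> inj_on (\<lambda>v. \<chi> (k, v)) e}"
  have edgeD: "\<exists>k<a. f k u = f k v \<and> \<chi> (k, u) \<noteq> \<chi> (k, v)" if "{u, v} \<in> E" "u \<noteq> v" for u v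
    using that by (auto simp: E_def on_line_def)
  have "simple_graph V E"
    using fin G(1) by (auto simp: simple_graph_def E_def joined_def)
  moreover have "K_free (s + 1) V E"
    unfolding K_free_def
  proof
    assume "\<exists>K\<in>nsets V (s + 1). clique K E"
    then obtain K where K: "K \<subseteq> V" "finite K" "card K = s + 1" "clique K E"
      by (auto simp: nsets_def)
    have adj: "{u, v} \<in> E" if "u \<in> K" "v \<in> K" "u \<noteq> v" for u v
      using K(4) that by (simp add: clique_def)
    have "\<not> card K \<le> Suc 0" using K(3) s by simp
    then obtain u v where uv: "u \<in> K" "v \<in> K" "u \<noteq> v"
      using card_le_Suc0_iff_eq[OF K(2)] by blast
    obtain k where k: "k < a" "f k u = f k v" using edgeD[OF adj[OF uv] uv(3)] by blast
    \<comment> \<open>Each third vertex forms a triangle of \<open>G\<close>, which must be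
      collinear; its line is the unique line through \<open>u\<close> and \<open>v\<close>.\<close>
    have line: "f k w = f k u" if w: "w \<in> K" for w
    proof (cases "w = u \<or> w = v")
      case False
      let ?Q = "{u, v, w}"
      have Q: "?Q \<in> nsets V 3" using False uv w K(1) by (auto simp: nsets_def)
      have "?Q \<subseteq> K" using uv w by simp
      then have QG: "nsets ?Q 2 \<subseteq> G"
        using adj by (auto simp: E_def elim!: nsets2_E simp del: insert_iff)
      then have "collinear ?Q" using G(1,2) Q unfolding triangles_def by blast
      then obtain l where l: "l < a" "f l u = f l v" "f l u = f l w"
        by (auto simp: collinear_def on_line_def)
      moreover have "u \<in> V" "v \<in> V" using uv K(1) by auto
      ultimately have "k = l" using slope_unique[of u v k l] uv(3) k by simp
      then show ?thesis using l by simp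
    qed (use k in auto)
    \<comment> \<open>The slope that witnesses the edge must be \<open>k\<close>, the slope of the
      line containing \<open>K\<close>.\<close>
    have "\<chi> (k, x) \<noteq> \<chi> (k, y)" if xy: "x \<in> K" "y \<in> K" "x \<noteq> y" for x y
    proof -
      obtain l where l: "l < a" "f l x = f l y" "\<chi> (l, x) \<noteq> \<chi> (l, y)"
        using edgeD[OF adj[OF xy] xy(3)] by blast
      have "f k x = f k y" using line[OF xy(1)] line[OF xy(2)] by simp
      moreover have "x \<in> V" "y \<in> V" using xy K(1) by auto
      ultimately have "k = l" using slope_unique[of x y k l] xy(3) k l by simp
      then show ?thesis using l by simp
    qed
    then have "inj_on (\<lambda>v. \<chi> (k, v)) K" by (auto simp: inj_on_def)
    moreover have "(\<lambda>v. \<chi> (k, v)) ` K \<subseteq> {..<s}" using \<chi>(1) k(1) K(1) by auto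
    ultimately have "card K \<le> card {..<s}" by (intro card_inj_on_le) auto
    then show False using K(3) by simp
  qed
  moreover have "\<not> K_free s W (induced_edges E W)" if W: "W \<in> nsets V (2 * M * (s ^ 2 * p))" for W
  proof -
    obtain k T where T: "k < a" "T \<in> nsets W s" "on_line k T" "nsets T 2 \<subseteq> G"
        "inj_on (\<lambda>v. \<chi> (k, v)) T"
      using \<chi>(2)[OF W] by blast
    have "{x, y} \<in> induced_edges E W" if "x \<in> T" "y \<in> T" "x \<noteq> y" for x y
    proof -
      have sub: "{x, y} \<subseteq> T" using that by simp
      have "{x, y} \<in> G" using T(4) that by auto
      then have "{x, y} \<in> E"
        using T(1) on_line_subset[OF T(3) sub] inj_on_subset[OF T(5) sub] by (auto simp: E_def)
      then show ?thesis using sub T(2) by (auto simp: induced_edges_def nsets_def)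
    qed
    then have "clique T (induced_edges E W)" by (simp add: clique_def)
    then show ?thesis using T(2) by (auto simp: K_free_def)
  qed
  ultimately show ?thesis by blast
qed

end

section \<open>The grid and the choice of parameters\<close>

text \<open>A set without \<open>s\<close>-cliques of size at least \<open>w\<close> would contain
  one of size exactly \<open>w\<close>, because the property passes to subsets.\<close>

lemma erdos_rogers_less:
  fixes V :: "nat set"
  assumes E: "simple_graph V E" "card V = n" "K_free t V E" and s: "s \<ge> 1"
    and W: "\<forall>W\<in>nsets V w. \<not> K_free s W (induced_edges E W)"
  shows "erdos_rogers s t n < w"
proof -
  have finV: "finite V" using E by (simp add: simple_graph_def)
  have small: "card X < w" if X: "X \<subseteq> V" "K_free s X (induced_edges E X)" for X
  proof (rule ccontr)
    assume "\<not> card X < w"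
    then obtain Y where Y: "Y \<subseteq> X" "card Y = w" "finite Y"
      using obtain_subset_with_card_n[of w X] by auto
    then have "Y \<in> nsets V w" using X by (auto simp: nsets_def)
    then obtain K where K: "K \<in> nsets Y s" "clique K (induced_edges E Y)"
      using W by (auto simp: K_free_def)
    then have "K \<in> nsets X s" "clique K (induced_edges E X)"
      using Y(1) by (auto simp: nsets_def clique_def induced_edges_def)
    then show False using X(2) by (auto simp: K_free_def)
  qed
  have "max_K_free s V E < w"
    unfolding max_K_free_def
    using Max_less_iff[OF finite_K_free_sizes[OF finV] K_free_sizes_nonempty[OF s]] small by auto
  moreover have "erdos_rogers s t n \<le> max_K_free s V E"
    unfolding erdos_rogers_def by (rule Min_le[OF finite_erdos_rogers_values[OF s]]) (use E in blast)
  ultimately show ?thesis by simp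
qed

text \<open>The vertex \<open>v < N ^ 2\<close> is the point \<open>(v div N, v mod N)\<close> of the \<open>N \<times> N\<close> grid.\<close>
definition intercept :: "nat \<Rightarrow> nat \<Rightarrow> nat \<Rightarrow> int" where
  "intercept N k v = int (v mod N) - int k * int (v div N)"

text \<open>Subtracting the two line equations gives equal slopes or equal first coordinates; in the
  latter case the second coordinates agree too.\<close>

lemma line_classes_grid:
  assumes "finite V" "a \<ge> 1"
  shows "line_classes V a (intercept N)"
proof
  fix u v k l :: nat
  assume "u \<noteq> v" and k: "intercept N k u = intercept N k v" and l: "intercept N l u = intercept N l v"
  from k l have "(int k - int l) * (int (u div N) - int (v div N)) = 0"
    unfolding intercept_def by algebra
  then consider "k = l" | "u div N = v div N" by auto
  then show "k = l"
  proof cases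
    case 2
    then have "u mod N = v mod N" using k by (simp add: intercept_def)
    with 2 have "u = v" by (metis div_mult_mod_eq)
    with \<open>u \<noteq> v\<close> show ?thesis by simp
  qed
qed (use assms in auto)

text \<open>With coordinates below \<open>N\<close> and slope at most \<open>a - 1\<close>, the
  intercepts lie in an integer interval of \<open>a * N\<close> elements.\<close>

lemma card_intercept_image:
  assumes "n \<le> N ^ 2" "N \<ge> 1" "k < a"
  shows "card (intercept N k ` {..<n}) \<le> a * N"
proof -
  have "intercept N k ` {..<n} \<subseteq> {- (int (a - 1) * int N)..<int N}"
  proof
    fix b assume "b \<in> intercept N k ` {..<n}"
    then obtain v where v: "v < n" "b = intercept N k v" by auto
    have "v < N * N" using v assms(1) by (simp add: power2_eq_square)
    then have "v div N < N" by (simp add: less_mult_imp_div_less)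
    then have "k * (v div N) \<le> (a - 1) * N" using assms(3) by (intro mult_le_mono) auto
    then have "int k * int (v div N) \<le> int (a - 1) * int N" by (metis of_nat_le_iff of_nat_mult)
    moreover have "0 \<le> int (v mod N)" "int (v mod N) < int N" using assms(2) by simp_all
    moreover have "0 \<le> int k * int (v div N)" by simp
    ultimately show "b \<in> {- (int (a - 1) * int N)..<int N}"
      unfolding v(2) intercept_def atLeastLessThan_iff by linarith
  qed
  then have "card (intercept N k ` {..<n}) \<le> card {- (int (a - 1) * int N)..<int N}"
    by (intro card_mono) auto
  also have "\<dots> = nat (int N + int (a - 1) * int N)" by simp
  also have "int N + int (a - 1) * int N = int (a * N)"
    using assms(3) by (simp add: of_nat_diff algebra_simps)
  finally show ?thesis by (simp only: nat_int)
qed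

text \<open>\<open>L\<close> replaces \<open>ln n\<close>; \<open>a\<close>, \<open>B\<close> and
  \<open>p\<close> are chosen just large enough for the preceding construction with
  \<open>M = a * N\<close>. The summands \<open>1\<close> in \<open>\<alpha>\<close> and
  \<open>p\<close> make the required inequalities strict.\<close>

lemma erdos_rogers_less_nat:
  fixes s n L N :: nat
  defines "c \<equiv> s choose 2"
  defines "\<alpha> \<equiv> 2 * s ^ (s + 1) + 1"
  assumes s: "s \<ge> 2" and n: "n \<ge> 1" "n \<le> N ^ 2" and L: "L \<ge> 1" "ln (real n) \<le> real L"
  shows "erdos_rogers s (s + 1) n
    < 2 * \<alpha> * s ^ 2 * (32 * s ^ 2 * c * \<alpha> ^ 4 * (2 * c * \<alpha> ^ 2) ^ c + 1) * N * L ^ (6 + 2 * c)"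
proof -
  define a where "a = \<alpha> * L"
  define B where "B = 2 * c * a ^ 2"
  define p where "p = 32 * s ^ 2 * c * a ^ 4 * B ^ c * L + 1"
  define \<beta> where "\<beta> = 32 * s ^ 2 * c * \<alpha> ^ 4 * (2 * c * \<alpha> ^ 2) ^ c"
  have c: "c \<ge> 1" using s by (simp add: c_def Suc_le_eq)
  have a: "a \<ge> 1" using L by (simp add: a_def \<alpha>_def)
  have N: "N \<ge> 1" using n by (cases N) auto
  interpret line_classes "{..<n}" a "intercept N"
    by (rule line_classes_grid) (use a in auto)
  have "\<exists>E. simple_graph {..<n} E \<and> K_free (s + 1) {..<n} E \<and>
    (\<forall>W\<in>nsets {..<n} (2 * (a * N) * (s ^ 2 * p)). \<not> K_free s W (induced_edges E W))"
  proof (rule exists_graph_without_large_K_free_set[where n = n and B = B])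
    show "2 * (s choose 2) * a ^ 2 \<le> B" by (simp add: B_def c_def)
    show "B \<ge> 1" using c a by (simp add: B_def)
    define D where "D = 32 * real s ^ 2 * real c * real a ^ 4 * real B ^ c"
    have "D * ln (real n) \<le> D * real L"
      using L(2) by (intro mult_left_mono) (auto simp: D_def)
    also have "\<dots> < real p" by (simp add: p_def D_def)
    finally show "32 * real s ^ 2 * real (s choose 2) * real a ^ 4 * real B ^ (s choose 2) * ln (real n) < real p"
      by (simp add: D_def c_def)
    have "2 * real s ^ (s + 1) * ln (real n) \<le> 2 * real s ^ (s + 1) * real L"
      using L(2) by (intro mult_left_mono) auto
    also have "\<dots> < (2 * real s ^ (s + 1) + 1) * real L"
      using L(1) by (intro mult_strict_right_mono) auto
    also have "\<dots> = real a" by (simp add: a_def \<alpha>_def algebra_simps)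
    finally show "2 * real s ^ (s + 1) * ln (real n) < real a" .
    show "card (intercept N k ` {..<n}) \<le> a * N" if "k < a" for k
      using n(2) N that by (rule card_intercept_image)
  qed (use s n a N in \<open>auto simp: p_def\<close>)
  then have "erdos_rogers s (s + 1) n < 2 * (a * N) * (s ^ 2 * p)"
    using erdos_rogers_less[of "{..<n}" _ n "s + 1" s] s by auto
  \<comment> \<open>Powers of \<open>L\<close> in \<open>p\<close>: four from \<open>a ^ 4\<close>,
    \<open>2 * c\<close> from \<open>B ^ c\<close> and one from the logarithm. The number of lines
    adds one more below.\<close>
  also have "p \<le> (\<beta> + 1) * L ^ (5 + 2 * c)"
  proof -
    have "p = \<beta> * L ^ (5 + 2 * c) + 1"
      by (simp add: p_def \<beta>_def B_def a_def power_mult_distrib power_add power_mult eval_nat_numeral)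
    also have "\<dots> \<le> \<beta> * L ^ (5 + 2 * c) + L ^ (5 + 2 * c)" using L(1) by simp
    finally show ?thesis by simp
  qed
  then have "2 * (a * N) * (s ^ 2 * p) \<le> 2 * (a * N) * (s ^ 2 * ((\<beta> + 1) * L ^ (5 + 2 * c)))"
    by (intro mult_le_mono) auto
  also have "\<dots> = 2 * \<alpha> * s ^ 2 * (\<beta> + 1) * N * L ^ (6 + 2 * c)"
  proof -
    have "L ^ (6 + 2 * c) = L * L ^ (5 + 2 * c)" by (simp flip: power_Suc)
    then show ?thesis by (simp only: a_def mult_ac)
  qed
  finally show ?thesis by (simp only: \<beta>_def)
qed

theorem theorem1:
  fixes s :: nat
  assumes "s \<ge> 3"
  shows "\<exists>c::real. c > 0 \<and>
    (\<forall>n::nat. n \<ge> 2 \<longrightarrow>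
      real (erdos_rogers s (s + 1) n) \<le> c * (ln (real n)) ^ (4 * s ^ 2) * sqrt (real n))"
proof -
  define c where "c = s choose 2"
  define \<alpha> where "\<alpha> = 2 * s ^ (s + 1) + 1"
  define \<gamma> where "\<gamma> = 2 * \<alpha> * s ^ 2 * (32 * s ^ 2 * c * \<alpha> ^ 4 * (2 * c * \<alpha> ^ 2) ^ c + 1)"
  define e where "e = 4 * s ^ 2"
  have \<gamma>: "\<gamma> > 0" using assms by (simp add: \<gamma>_def \<alpha>_def)
  have "2 * c \<le> s * (s - 1)" unfolding c_def choose_two by (rule times_div_less_eq_dividend)
  also have "\<dots> \<le> s * s" by simp
  finally have "2 * c \<le> s * s" .
  moreover have "3 * 3 \<le> s * s" using assms by (intro mult_le_mono)
  ultimately have exp_le: "6 + 2 * c \<le> e" by (simp add: e_def power2_eq_square)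
  show ?thesis
  \<comment> \<open>The factor \<open>2\<close> comes from rounding up the square root, and
    \<open>3 ^ e\<close> from rounding up the logarithm.\<close>
  proof (intro exI[of _ "2 * real \<gamma> * 3 ^ e"] conjI allI impI)
    show "0 < 2 * real \<gamma> * 3 ^ e" using \<gamma> by simp
    fix n :: nat
    assume n: "n \<ge> 2"
    define L where "L = nat \<lceil>ln (real n)\<rceil>"
    define N where "N = nat \<lceil>sqrt (real n)\<rceil>"
    \<comment> \<open>The lower bound \<open>1 / 2\<close> gives
      \<open>ln n + 1 \<le> 3 * ln n\<close>, which controls the ceiling \<open>L\<close>.\<close>
    have "ln 2 \<le> ln (real n)" using n by simp
    then have ln_half: "1 / 2 \<le> ln (real n)"
      using ln_le_minus_one[of "1 / 2"] by (simp add: ln_div)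
    have L: "ln (real n) \<le> real L" "real L \<le> 3 * ln (real n)"
      using ln_half unfolding L_def by linarith+
    then have L1: "L \<ge> 1" using ln_half by (cases L) auto
    have sqrt1: "1 \<le> sqrt (real n)" using n by simp
    have N: "sqrt (real n) \<le> real N" "real N \<le> 2 * sqrt (real n)"
      using sqrt1 unfolding N_def by linarith+
    have "real n = sqrt (real n) ^ 2" by simp
    also have "\<dots> \<le> real N ^ 2" using N(1) by (intro power_mono) auto
    finally have nN: "n \<le> N ^ 2" by (metis of_nat_le_iff of_nat_power)
    have "erdos_rogers s (s + 1) n < \<gamma> * N * L ^ (6 + 2 * c)"
      using erdos_rogers_less_nat[of s n N L] assms n nN L1 L(1)
      unfolding \<gamma>_def \<alpha>_def c_def by simp
    also have "\<dots> \<le> \<gamma> * N * L ^ e"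
      using exp_le L1 by (intro mult_le_mono2 power_increasing)
    finally have "real (erdos_rogers s (s + 1) n) \<le> real (\<gamma> * N * L ^ e)"
      by (intro of_nat_mono) simp
    also have "\<dots> = real \<gamma> * real N * real L ^ e" by simp
    also have "\<dots> \<le> real \<gamma> * (2 * sqrt (real n)) * (3 * ln (real n)) ^ e"
      using N L by (intro mult_mono power_mono mult_left_mono) auto
    also have "\<dots> = 2 * real \<gamma> * 3 ^ e * ln (real n) ^ e * sqrt (real n)"
      by (simp add: power_mult_distrib)
    finally show "real (erdos_rogers s (s + 1) n)
        \<le> 2 * real \<gamma> * 3 ^ e * ln (real n) ^ (4 * s ^ 2) * sqrt (real n)"
      by (simp add: e_def)
  qed
qed

end
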